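(* Let $\alpha>0$, $\delta>0$, $X\in Par(\alpha,\delta)$, let $s\in\{2,3,\dots\}$ be fixed, and let $\alpha_0\in(0,1)$. For $k\in\mathbb{N}$ let $X_{(1,n)}\le\dots\le X_{(n,n)}$ be the order statistics of $n=k(s+1)-1$ independent observations on $X$, and put $L_{k,s}=\log\frac{X_{(ks,(s+1)k-1)}}{X_{(k,(s+1)k-1)}}$. Then $$\left[\frac{\log(s)}{L_{k,s}}-\frac{z_{1-\frac{\alpha_0}{2}}}{L_{k,s}}\sqrt{\frac{s^2-1}{s[k(s+1)-1]}}\,;\ \frac{\log(s)}{L_{k,s}}+\frac{z_{1-\frac{\alpha_0}{2}}}{L_{k,s}}\sqrt{\frac{s^2-1}{s[k(s+1)-1]}}\right]$$ is an asymptotic confidence interval for $\alpha$ of level $1-\alpha_0$ as $k\to\infty$; that is, the probability that $\alpha$ belongs to this interval converges to $1-\alpha_0$ as $k\to\infty$.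
   Context: $X\in Par(\alpha,\delta)$ means that $X$ has c.d.f. $F_X(x)=0$ for $x\le\delta$ and $F_X(x)=1-(\delta/x)^{\alpha}$ for $x>\delta$. $X_{(i,n)}$ denotes the $i$-th smallest of $n$ independent observations on $X$. $z_{1-\frac{\alpha_0}{2}}$ denotes the $(1-\frac{\alpha_0}{2})$-quantile of the standard normal distribution, and $\log$ is the natural logarithm. *)

theory Defs
  imports "HOL-Probability.Probability"
begin

definition pareto_cdf :: "real \<Rightarrow> real \<Rightarrow> real \<Rightarrow> real" where
  "pareto_cdf \<alpha> \<delta> x = (if x \<le> \<delta> then 0 else 1 - (\<delta> / x) powr \<alpha>)"

definition pareto_rv :: "'a measure \<Rightarrow> ('a \<Rightarrow> real) \<Rightarrow> real \<Rightarrow> real \<Rightarrow> bool" where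
  "pareto_rv M Y \<alpha> \<delta> \<longleftrightarrow>
     Y \<in> borel_measurable M \<and> (\<forall>x. cdf (distr M borel Y) x = pareto_cdf \<alpha> \<delta> x)"

text \<open>Order statistics are 1-based, as are the observations \<open>x 1, \<dots>, x n\<close>;
  the value is meaningful for \<open>1 \<le> i \<le> n\<close>.\<close>

definition order_stat :: "nat \<Rightarrow> nat \<Rightarrow> (nat \<Rightarrow> real) \<Rightarrow> real" where
  "order_stat i n x = sort (map x [1..<Suc n]) ! (i - 1)"

definition quantile :: "real measure \<Rightarrow> real \<Rightarrow> real" where
  "quantile D p = Inf {x. p \<le> cdf D x}"

definition log_ratio :: "nat \<Rightarrow> nat \<Rightarrow> (nat \<Rightarrow> real) \<Rightarrow> real" where
  "log_ratio k s x =
     ln (order_stat (k * s) ((s + 1) * k - 1) x / order_stat k ((s + 1) * k - 1) x)"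

definition ci_halfwidth :: "real \<Rightarrow> nat \<Rightarrow> nat \<Rightarrow> (nat \<Rightarrow> real) \<Rightarrow> real" where
  "ci_halfwidth \<alpha>\<^sub>0 k s x =
     quantile std_normal_distribution (1 - \<alpha>\<^sub>0 / 2) / log_ratio k s x *
     sqrt ((real s ^ 2 - 1) / (real s * (real k * (real s + 1) - 1)))"

end

(* The logarithm of a Pareto variable is a shifted exponential variable, hence memoryless: given the
   k-th order statistic, the remaining k s - 1 observations exceed it by a factor larger than exp y
   independently, with probability q = exp (- alpha y). So L <= y means that a Binomial(k s - 1, q)
   variable is at most k - 1, exactly and for every k. Taking alpha y = ln s + u sigma_k with sigma_k
   the square root in the interval, q tends to 1 / s and the mean of the binomial variable differs
   from k - 1 by about - u standard deviations. A central limit theorem for triangular arrays of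
   binomial variables then shows that (alpha L - ln s) / sigma_k is asymptotically standard normal.
   Since L > 0 almost surely, alpha lies in the interval iff this quantity lies in [- z, z]. *)

theory Submission
  imports Defs
begin

section \<open>Order statistics\<close>

text \<open>Fixing the value of an order statistic means conditioning on a null event. This is
  avoided by cutting the sample space into finitely many cells: a cell records which observation has
  rank \<open>a\<close>, which ones are smaller, and which ones exceed its image under
  \<open>h\<close>. Its probability is a single Fubini integral, from which the tail identity
  extracts a binomial weight. The factor left over is a beta integral common to all cells, and total
  mass one determines it. The success probability q = exp (- ln s - u \<sigma>_k) moves with k, so a
  limit theorem for one fixed law does not apply; characteristic functions with a Taylor bound
  uniform in q take its place. The scale \<sigma>_k fits because the binomial mean is shifted by
  about - u k \<sigma>_k, the binomial variance is about k (s - 1) / s, and k \<sigma>_k^2 tends to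
  (s - 1) / s.\<close>

lemma sorted_nth_le_iff:
  fixes ys :: "'a::linorder list"
  assumes "sorted ys" and "k < length ys"
  shows "ys ! k \<le> t \<longleftrightarrow> k < length (filter (\<lambda>y. y \<le> t) ys)"
  using assms
proof (induction ys arbitrary: k)
  case (Cons y ys)
  show ?case
  proof (cases "y \<le> t")
    case True
    with Cons show ?thesis by (cases k) auto
  next
    case False
    with Cons.prems(1) have "filter (\<lambda>y. y \<le> t) (y # ys) = []"
      by (auto simp: filter_empty_conv)
    moreover have "y \<le> (y # ys) ! k"
      using Cons.prems by (cases k) auto
    ultimately show ?thesis using False by auto
  qed
qed simp

text \<open>Sorting preserves the number of values that are at most \<open>t\<close>, and in the
  sorted list these form an initial segment. This replaces sorting by counting.\<close>

lemma order_stat_le_iff: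
  assumes "1 \<le> i" "i \<le> n"
  shows "order_stat i n x \<le> t \<longleftrightarrow> i \<le> card {j\<in>{1..n}. x j \<le> t}"
proof -
  let ?xs = "map x [1..<Suc n]"
  have "length (filter (\<lambda>y. y \<le> t) (sort ?xs)) = length (filter (\<lambda>y. y \<le> t) ?xs)"
    by (metis filter_sort length_sort)
  also have "\<dots> = card {j\<in>{1..n}. x j \<le> t}"
    by (auto simp: filter_map comp_def distinct_length_filter simp del: upt_Suc intro!: arg_cong[where f = card])
  finally show ?thesis
    using assms sorted_nth_le_iff[of "sort ?xs" "i - 1" t] by (auto simp: order_stat_def simp del: upt_Suc)
qed

lemma order_stat_eqI:
  assumes "1 \<le> i" "i \<le> n"
    and "card {j\<in>{1..n}. x j < v} < i" "i \<le> card {j\<in>{1..n}. x j \<le> v}"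
  shows "order_stat i n x = v"
proof (rule antisym)
  show "order_stat i n x \<le> v" using assms by (simp add: order_stat_le_iff)
  show "v \<le> order_stat i n x"
  proof (rule ccontr)
    assume *: "\<not> v \<le> order_stat i n x"
    have "i \<le> card {j\<in>{1..n}. x j \<le> order_stat i n x}"
      using assms order_stat_le_iff[of i n x "order_stat i n x"] by simp
    also have "\<dots> \<le> card {j\<in>{1..n}. x j < v}"
      using * by (intro card_mono) auto
    finally show False using assms by simp
  qed
qed

lemma order_stat_mem:
  assumes "1 \<le> i" "i \<le> n"
  shows "\<exists>j\<in>{1..n}. order_stat i n x = x j"
proof -
  have "order_stat i n x \<in> set (sort (map x [1..<Suc n]))"
    unfolding order_stat_def using assms by (intro nth_mem) auto
  then show ?thesis by (auto simp del: upt_Suc)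
qed

text \<open>If \<open>i\<close> values were strictly smaller, their maximum would already satisfy
  the counting criterion and bound the order statistic from above.\<close>

lemma card_less_order_stat:
  assumes "1 \<le> i" "i \<le> n"
  shows "card {j\<in>{1..n}. x j < order_stat i n x} < i"
proof (rule ccontr)
  let ?v = "order_stat i n x" and ?A = "{j\<in>{1..n}. x j < order_stat i n x}"
  assume "\<not> card ?A < i"
  then have card: "i \<le> card ?A" by simp
  with assms have "0 < card ?A" by linarith
  then have ne: "?A \<noteq> {}" unfolding card_gt_0_iff by blast
  define t where "t = Max (x ` ?A)"
  have "t \<in> x ` ?A" using ne by (auto simp: t_def intro!: Max_in)
  then have "t < ?v" by auto
  have "?A \<subseteq> {j\<in>{1..n}. x j \<le> t}" by (auto simp: t_def)
  then have "card ?A \<le> card {j\<in>{1..n}. x j \<le> t}" by (intro card_mono) auto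
  with card have "i \<le> card {j\<in>{1..n}. x j \<le> t}" by linarith
  then have "?v \<le> t" using order_stat_le_iff[OF assms] by blast
  with \<open>t < ?v\<close> show False by simp
qed

text \<open>By counting, the sublevel sets of an order statistic are superlevel sets of a finite sum
  of indicators.\<close>

lemma borel_measurable_order_stat:
  assumes "1 \<le> i" "i \<le> n"
    and meas: "\<And>j. j \<in> {1..n} \<Longrightarrow> Y j \<in> borel_measurable M"
  shows "(\<lambda>\<omega>. order_stat i n (\<lambda>j. Y j \<omega>)) \<in> borel_measurable M"
proof (subst borel_measurable_iff_le, intro allI)
  fix t :: real
  have eq: "real (card {j\<in>{1..n}. Y j \<omega> \<le> t}) = (\<Sum>j\<in>{1..n}. indicator {..t} (Y j \<omega>))" for \<omega>
    by (simp add: indicator_def if_distrib sum.If_cases Int_def conj_commute)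
  have "(\<lambda>\<omega>. \<Sum>j\<in>{1..n}. indicator {..t} (Y j \<omega>) :: real) \<in> borel_measurable M"
    by (intro borel_measurable_sum measurable_compose[OF meas] borel_measurable_indicator) auto
  then have "{\<omega> \<in> space M. real i \<le> (\<Sum>j\<in>{1..n}. indicator {..t} (Y j \<omega>))} \<in> sets M"
    by measurable
  then show "{\<omega> \<in> space M. order_stat i n (\<lambda>j. Y j \<omega>) \<le> t} \<in> sets M"
    unfolding eq[symmetric] of_nat_le_iff order_stat_le_iff[OF assms(1,2)] .
qed

section \<open>Binomial probabilities as sums over sets of successes\<close>

lemma sum_subsets_card_le:
  fixes f :: "nat \<Rightarrow> real"
  assumes "finite S"
  shows "(\<Sum>C | C \<subseteq> S \<and> card C \<le> m. f (card C)) = (\<Sum>j\<le>m. real (card S choose j) * f j)"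
proof -
  have "(\<Sum>C | C \<subseteq> S \<and> card C \<le> m. f (card C)) =
      (\<Sum>j\<le>m. \<Sum>C | C \<in> {C. C \<subseteq> S \<and> card C \<le> m} \<and> card C = j. f (card C))"
    using assms by (intro sum.group[symmetric]) auto
  also have "\<dots> = (\<Sum>j\<le>m. real (card S choose j) * f j)"
  proof (rule sum.cong[OF refl])
    fix j assume "j \<in> {..m}"
    then have "{C. C \<in> {C. C \<subseteq> S \<and> card C \<le> m} \<and> card C = j} = {C. C \<subseteq> S \<and> card C = j}"
      by auto
    then show "(\<Sum>C | C \<in> {C. C \<subseteq> S \<and> card C \<le> m} \<and> card C = j. f (card C)) = real (card S choose j) * f j"
      using n_subsets[OF assms, of j] by simp
  qed
  finally show ?thesis .
qed

text \<open>\<open>C\<close> plays the set of successful trials. In this form the binomial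
  distribution function matches a sum of cell probabilities.\<close>

lemma sum_subsets_binomial:
  assumes "finite S" "q \<in> {0..1}"
  shows "(\<Sum>C | C \<subseteq> S \<and> card C \<le> m. q ^ card C * (1 - q) ^ (card S - card C)) =
    measure (binomial_pmf (card S) q) {..m}"
  unfolding sum_subsets_card_le[OF assms(1), of "\<lambda>j. q ^ j * (1 - q) ^ (card S - j)" m]
  using assms(2) by (simp add: measure_measure_pmf_finite mult.assoc)

section \<open>Memoryless tails and pairs of order statistics\<close>

context real_distribution
begin

abbreviation iid_sample :: "'i set \<Rightarrow> ('i \<Rightarrow> real) measure" where
  "iid_sample I \<equiv> PiM I (\<lambda>_. M)"

text \<open>Fubini: once all coordinates but \<open>i\<close> are fixed, a tie forces coordinate
  \<open>i\<close> to hit the single point \<open>x j\<close>, which has no mass.\<close>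

lemma AE_iid_sample_neq:
  assumes atomless: "\<And>t. measure M {t} = 0"
    and I: "finite I" "i \<in> I" "j \<in> I" "i \<noteq> j"
  shows "AE x in iid_sample I. x i \<noteq> x j"
proof -
  interpret product_sigma_finite "\<lambda>_. M" by standard
  have I_eq: "I = insert i (I - {i})" using I by auto
  have [measurable]: "(\<lambda>x. x i) \<in> borel_measurable (iid_sample I)" "(\<lambda>x. x j) \<in> borel_measurable (iid_sample I)"
    using I by (auto intro!: measurable_component_singleton[THEN measurable_compose, of _ _ _ "\<lambda>x. x"])
  let ?S = "{x \<in> space (iid_sample I). x i = x j}"
  have S: "?S \<in> sets (iid_sample I)" by measurable
  have "emeasure (iid_sample I) ?S = (\<integral>\<^sup>+x. indicator ?S x \<partial>iid_sample (insert i (I - {i})))"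
    using S I_eq by simp
  also have "\<dots> = (\<integral>\<^sup>+x. (\<integral>\<^sup>+y. indicator ?S (x(i := y)) \<partial>M) \<partial>iid_sample (I - {i}))"
    using I S by (intro product_nn_integral_insert) (auto simp: insert_absorb)
  also have "\<dots> = (\<integral>\<^sup>+x. (\<integral>\<^sup>+y. indicator {x j} y \<partial>M) \<partial>iid_sample (I - {i}))"
    using I by (intro nn_integral_cong)
      (auto simp: indicator_def space_PiM PiE_def extensional_def Pi_def)
  also have "\<dots> = 0"
    using atomless by (simp add: emeasure_eq_measure)
  finally show ?thesis
    using S by (subst AE_iff_null) (auto simp: null_sets_def)
qed

text \<open>Fixes which observations lie below \<open>x i\<close> and which exceed \<open>h (x i)\<close>. The apparently redundant
  \<open>x i < x j\<close> makes distinct cells disjoint even where \<open>h t < t\<close>.\<close>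

definition cell :: "'i set \<Rightarrow> (real \<Rightarrow> real) \<Rightarrow> 'i \<Rightarrow> 'i set \<Rightarrow> 'i set \<Rightarrow> ('i \<Rightarrow> real) set" where
  "cell I h i A C = {x \<in> space (iid_sample I).
     (\<forall>j\<in>A. x j < x i) \<and> (\<forall>j\<in>C. x i < x j \<and> h (x i) < x j) \<and>
     (\<forall>j\<in>I - {i} - A - C. x i < x j \<and> x j \<le> h (x i))}"

lemma sets_cell:
  assumes "finite I" "i \<in> I" "A \<subseteq> I" "C \<subseteq> I" and [measurable]: "h \<in> borel_measurable borel"
  shows "cell I h i A C \<in> sets (iid_sample I)"
proof -
  have [measurable]: "(\<lambda>x. x j) \<in> borel_measurable (iid_sample I)" if "j \<in> I" for j
    using that by (auto intro!: measurable_component_singleton[THEN measurable_compose, of _ _ _ "\<lambda>x. x"])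
  have fin: "finite A" "finite C" "finite (I - {i} - A - C)"
    using assms(1-4) by (auto intro: finite_subset[of _ I])
  have m: "{x \<in> space (iid_sample I). P (x i) (x j)} \<in> sets (iid_sample I)"
    if "j \<in> I" "Measurable.pred (borel \<Otimes>\<^sub>M borel) (case_prod P)" for j P
  proof -
    have "(\<lambda>x. (x i, x j)) \<in> measurable (iid_sample I) (borel \<Otimes>\<^sub>M borel)"
      using that assms by measurable
    from measurable_compose[OF this that(2)] show ?thesis by (simp add: pred_def)
  qed
  show ?thesis
    unfolding cell_def using assms fin
    by (intro sets.sets_Collect_conj sets.sets_Collect_finite_All m) (auto simp: case_prod_beta)
qed

text \<open>With the coordinate \<open>i\<close> fixed at \<open>t\<close> and integrated out last,
  the cell becomes a box in the other coordinates. The tail identity gives each side indexed by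
  \<open>C\<close> the mass q G(t) and each side between \<open>t\<close> and \<open>h t\<close> the
  mass (1 - q) G(t), where G is the upper tail. So \<open>C\<close> influences only a constant
  weight, and the remaining integral depends on the cell through \<open>card A\<close> and
  \<open>N\<close> alone.\<close>

lemma emeasure_cell:
  assumes I: "finite I" "i \<in> I" "A \<subseteq> I - {i}" "C \<subseteq> I - {i} - A" and N: "N = card (I - {i} - A)"
    and h[measurable]: "h \<in> borel_measurable borel"
    and q: "0 \<le> q" "q \<le> 1"
    and tail: "AE t in M. t \<le> h t \<and> measure M {h t<..} = q * measure M {t<..}"
  shows "emeasure (iid_sample I) (cell I h i A C) =
     ennreal (q ^ card C * (1 - q) ^ (N - card C)) *
     (\<integral>\<^sup>+t. ennreal (measure M {..<t} ^ card A * measure M {t<..} ^ N) \<partial>M)"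
proof -
  interpret product_sigma_finite "\<lambda>_. M" by standard
  let ?J = "I - {i}"
  have I_eq: "insert i ?J = I" using I by auto
  have S: "cell I h i A C \<in> sets (iid_sample I)" using I h by (intro sets_cell) auto
  \<comment> \<open>The bound \<open>max t (h t)\<close> encodes both inequalities imposed on
    \<open>C\<close> in \<open>cell\<close>; for almost every \<open>t\<close> it equals
    \<open>h t\<close>.\<close>
  define B where "B t j = (if j \<in> A then {..<t} else if j \<in> C then {max t (h t)<..} else {t<..h t})" for t j
  have fin: "finite A" "finite C" "finite ?J"
    using I by (auto intro: finite_subset[of _ I])
  have cardC: "card C \<le> N" unfolding N using I by (intro card_mono) auto
  have "emeasure (iid_sample I) (cell I h i A C) = (\<integral>\<^sup>+x. indicator (cell I h i A C) x \<partial>iid_sample (insert i ?J))"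
    using S I_eq by simp
  also have "\<dots> = (\<integral>\<^sup>+t. (\<integral>\<^sup>+x. indicator (cell I h i A C) (x(i := t)) \<partial>iid_sample ?J) \<partial>M)"
    using I S by (intro product_nn_integral_insert_rev) (auto simp: insert_absorb)
  also have "\<dots> = (\<integral>\<^sup>+t. (\<integral>\<^sup>+x. indicator (PiE ?J (B t)) x \<partial>iid_sample ?J) \<partial>M)"
  proof (intro nn_integral_cong)
    fix t x assume "x \<in> space (iid_sample ?J)"
    then have "x \<in> extensional ?J" by (auto simp: space_PiM PiE_def)
    then have "x(i := t) \<in> cell I h i A C \<longleftrightarrow> x \<in> PiE ?J (B t)"
      using I unfolding cell_def B_def
      by (auto simp: space_PiM PiE_iff extensional_def split: if_splits)
    then show "indicator (cell I h i A C) (x(i := t)) = (indicator (PiE ?J (B t)) x :: ennreal)"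
      by (simp add: indicator_def)
  qed
  also have "\<dots> = (\<integral>\<^sup>+t. emeasure (iid_sample ?J) (PiE ?J (B t)) \<partial>M)"
    using fin by (intro nn_integral_cong nn_integral_indicator sets_PiM_I_finite) (auto simp: B_def)
  also have "\<dots> = (\<integral>\<^sup>+t. (\<Prod>j\<in>?J. emeasure M (B t j)) \<partial>M)"
    using fin by (intro nn_integral_cong emeasure_PiM) (auto simp: B_def)
  also have "\<dots> = (\<integral>\<^sup>+t. ennreal (q ^ card C * (1 - q) ^ (N - card C)) *
      ennreal (measure M {..<t} ^ card A * measure M {t<..} ^ N) \<partial>M)"
  proof (intro nn_integral_cong_AE, use tail in eventually_elim)
    fix t assume t: "t \<le> h t \<and> measure M {h t<..} = q * measure M {t<..}"
    let ?G = "measure M {t<..}"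
    have "measure M {t<..h t} = measure M {t<..} - measure M {h t<..}"
      using t by (subst finite_measure_Diff[symmetric]) (auto intro!: arg_cong[where f = "measure M"])
    with t have mid: "measure M {t<..h t} = (1 - q) * ?G" by (simp add: algebra_simps)
    have J: "?J = A \<union> (C \<union> (?J - A - C))" using I by auto
    have "(\<Prod>j\<in>?J. measure M (B t j)) =
       (\<Prod>j\<in>A. measure M (B t j)) * ((\<Prod>j\<in>C. measure M (B t j)) * (\<Prod>j\<in>?J - A - C. measure M (B t j)))"
      using I fin by (subst J, subst prod.union_disjoint, (auto)[3], subst prod.union_disjoint) auto
    also have "(\<Prod>j\<in>A. measure M (B t j)) = measure M {..<t} ^ card A"
      by (simp add: B_def)
    also have "(\<Prod>j\<in>C. measure M (B t j)) = (q * ?G) ^ card C"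
      using I t by (subst prod.cong[OF refl, where h = "\<lambda>_. q * ?G"]) (auto simp: B_def max_def)
    also have "(\<Prod>j\<in>?J - A - C. measure M (B t j)) = ((1 - q) * ?G) ^ (N - card C)"
      using mid I fin by (simp add: B_def N card_Diff_subset)
    also have "measure M {..<t} ^ card A * ((q * ?G) ^ card C * ((1 - q) * ?G) ^ (N - card C)) =
       (q ^ card C * (1 - q) ^ (N - card C)) * (measure M {..<t} ^ card A * ?G ^ (card C + (N - card C)))"
      by (simp add: power_mult_distrib power_add)
    also have "card C + (N - card C) = N" using cardC by simp
    finally show "(\<Prod>j\<in>?J. emeasure M (B t j)) = ennreal (q ^ card C * (1 - q) ^ (N - card C)) *
      ennreal (measure M {..<t} ^ card A * measure M {t<..} ^ N)"
      using q by (simp add: emeasure_eq_measure prod_ennreal ennreal_mult[symmetric])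
  qed
  also have "\<dots> = ennreal (q ^ card C * (1 - q) ^ (N - card C)) *
     (\<integral>\<^sup>+t. ennreal (measure M {..<t} ^ card A * measure M {t<..} ^ N) \<partial>M)"
  proof (rule nn_integral_cmult)
    \<comment> \<open>Monotone functions are Borel; the upper tail is decreasing, hence the
      sign.\<close>
    have "(\<lambda>t. measure M {..<t}) \<in> borel_measurable borel" "(\<lambda>t. - measure M {t<..}) \<in> borel_measurable borel"
      by (intro borel_measurable_mono monoI le_imp_neg_le finite_measure_mono; auto)+
    then show "(\<lambda>t. ennreal (measure M {..<t} ^ card A * measure M {t<..} ^ N)) \<in> borel_measurable M"
      by (auto simp: borel_measurable_uminus_eq)
  qed
  finally show ?thesis .
qed

text \<open>The three conditions in \<open>cell\<close> exclude one another and cover every index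
  other than \<open>i\<close>, so a point of the cell determines \<open>A\<close> and
  \<open>C\<close> once \<open>i\<close> is known.\<close>

lemma cell_eqs:
  assumes i: "i \<in> I" "A \<subseteq> I - {i}" "C \<subseteq> I - {i} - A" and x: "x \<in> cell I h i A C"
  shows "A = {j\<in>I. x j < x i}" "C = {j\<in>I. x i < x j \<and> h (x i) < x j}" "\<forall>j\<in>I - {i}. x j \<noteq> x i"
proof -
  have *: "j = i \<or> j \<in> A \<and> x j < x i \<or> j \<in> C \<and> x i < x j \<and> h (x i) < x j \<or>
      j \<notin> A \<and> j \<notin> C \<and> x i < x j \<and> x j \<le> h (x i)" if "j \<in> I" for j
    using that x unfolding cell_def by blast
  have A: "x j < x i" if "j \<in> A" for j using that x unfolding cell_def by blast
  have C: "x i < x j \<and> h (x i) < x j" if "j \<in> C" for j using that x unfolding cell_def by blast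
  show "A = {j\<in>I. x j < x i}"
  proof (intro equalityI subsetI)
    show "j \<in> A" if "j \<in> {j\<in>I. x j < x i}" for j using that *[of j] by auto
  qed (use A i in auto)
  show "C = {j\<in>I. x i < x j \<and> h (x i) < x j}"
  proof (intro equalityI subsetI)
    show "j \<in> C" if "j \<in> {j\<in>I. x i < x j \<and> h (x i) < x j}" for j using that *[of j] by auto
  qed (use C i in auto)
  show "\<forall>j\<in>I - {i}. x j \<noteq> x i" using * by fastforce
qed

text \<open>Equal cardinality of \<open>A\<close> and \<open>A'\<close> gives \<open>i\<close> and
  \<open>i'\<close> the same rank. If they differed, their values would differ too, and the set
  below the smaller one would be a proper subset of the set below the larger one.\<close>

lemma disjoint_cell:
  assumes I: "finite I" "i \<in> I" "A \<subseteq> I - {i}" "C \<subseteq> I - {i} - A"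
    and I': "i' \<in> I" "A' \<subseteq> I - {i'}" "C' \<subseteq> I - {i'} - A'"
    and card: "card A = card A'" and x: "x \<in> cell I h i A C" "x \<in> cell I h i' A' C'"
  shows "i = i' \<and> A = A' \<and> C = C'"
proof -
  note c = cell_eqs[OF I(2-4) x(1)] and c' = cell_eqs[OF I' x(2)]
  have "i = i'"
  proof (rule ccontr)
    assume "i \<noteq> i'"
    with c(3) I'(1) consider "x i < x i'" | "x i' < x i" by (metis Diff_iff empty_iff insert_iff linorder_neq_iff)
    then show False
    proof cases
      case 1
      then have "i \<in> A'" using I(2) by (subst c'(1)) simp
      moreover have "A \<subseteq> A'" using 1 by (subst c(1), subst c'(1)) auto
      ultimately have "A \<subset> A'" using I(3) by blast
      moreover have "finite A'" using I(1) I'(2) finite_subset by blast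
      ultimately show False using card psubset_card_mono[of A' A] by simp
    next
      case 2
      then have "i' \<in> A" using I'(1) by (subst c(1)) simp
      moreover have "A' \<subseteq> A" using 2 by (subst c(1), subst c'(1)) auto
      ultimately have "A' \<subset> A" using I'(2) by blast
      moreover have "finite A" using I(1) I(3) finite_subset by blast
      ultimately show False using card psubset_card_mono[of A A'] by simp
    qed
  qed
  then show ?thesis using c(1,2) c'(1,2) by (metis (no_types))
qed

text \<open>Exactly \<open>a - 1\<close> values lie below \<open>x i\<close>, which gives it rank
  \<open>a\<close>. Because \<open>x i \<le> h (x i)\<close>, the observations bounded by
  \<open>h (x i)\<close> are precisely those outside \<open>C\<close>, and at least \<open>b\<close>
  of them are required.\<close>

lemma order_stat_on_cell:
  assumes ab: "1 \<le> a" "a \<le> n" "1 \<le> b" "b \<le> n"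
    and i: "i \<in> {1..n}" "A \<subseteq> {1..n} - {i}" "card A = a - 1" "C \<subseteq> {1..n} - {i} - A"
    and x: "x \<in> cell {1..n} h i A C" and h: "x i \<le> h (x i)"
  shows "order_stat a n x = x i"
    and "order_stat b n x \<le> h (x i) \<longleftrightarrow> card C \<le> n - b"
proof -
  have A: "{j\<in>{1..n}. x j < x i} = A"
    using cell_eqs(1)[OF i(1,2,4) x] by simp
  have C_iff: "j \<in> C \<longleftrightarrow> j \<in> {1..n} \<and> x i < x j \<and> h (x i) < x j" for j
    using cell_eqs(2)[OF i(1,2,4) x] by blast
  have C: "{j\<in>{1..n}. x j \<le> h (x i)} = {1..n} - C"
    using h by (auto simp: C_iff)
  have "insert i A \<subseteq> {j\<in>{1..n}. x j \<le> x i}" using A i(1) less_imp_le by blast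
  then have "card (insert i A) \<le> card {j\<in>{1..n}. x j \<le> x i}" by (intro card_mono) auto
  moreover have "finite A" using i(2) by (rule finite_subset) simp
  ultimately show "order_stat a n x = x i"
    using ab i unfolding A[symmetric] by (intro order_stat_eqI) (auto simp: card_insert_if split: if_splits)
  have "C \<subseteq> {1..n}" using i(4) by blast
  moreover from this have "finite C" by (rule finite_subset) simp
  ultimately have "card ({1..n} - C) = n - card C" "card C \<le> n"
    using card_mono[of "{1..n}" C] by (auto simp: card_Diff_subset)
  then show "order_stat b n x \<le> h (x i) \<longleftrightarrow> card C \<le> n - b"
    using ab unfolding order_stat_le_iff[OF ab(3,4)] C by linarith
qed

text \<open>Conditionally on the \<open>a\<close>-th order statistic \<open>t\<close>, the \<open>n - a\<close> larger observations are
  independent and exceed \<open>h t\<close> with probability \<open>q\<close>, whatever \<open>t\<close> is. All cells have the same probability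
  up to a binomial weight; the common factor is found by summing over all of them.\<close>

lemma prob_order_stat_le:
  assumes atomless: "\<And>t. measure M {t} = 0"
    and h[measurable]: "h \<in> borel_measurable borel"
    and q: "0 \<le> q" "q \<le> 1"
    and tail: "AE t in M. t \<le> h t \<and> measure M {h t<..} = q * measure M {t<..}"
    and ab: "1 \<le> a" "a \<le> n" "1 \<le> b" "b \<le> n"
  shows "measure (iid_sample {1..n}) {x \<in> space (iid_sample {1..n}). order_stat b n x \<le> h (order_stat a n x)} =
    measure (binomial_pmf (n - a) q) {..n - b}"
proof -
  let ?I = "{1..n}" and ?N = "n - a"
  interpret P: prob_space "iid_sample ?I" by (intro prob_space_PiM prob_space_axioms)
  \<comment> \<open>A pair in \<open>P\<close> names the observation of rank \<open>a\<close> and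
    the \<open>a - 1\<close> smaller ones. Up to null sets, \<open>U m\<close> is the event that at
    most \<open>m\<close> observations exceed \<open>h\<close> of the \<open>a\<close>-th order
    statistic.\<close>
  define P where "P = (SIGMA i:?I. {A. A \<subseteq> ?I - {i} \<and> card A = a - 1})"
  define J where "J m = (SIGMA p:P. {C. C \<subseteq> ?I - {fst p} - snd p \<and> card C \<le> m})" for m
  define U where "U m = (\<Union>(p, C)\<in>J m. cell ?I h (fst p) (snd p) C)" for m
  define c where "c = enn2real (\<integral>\<^sup>+t. ennreal (measure M {..<t} ^ (a - 1) * measure M {t<..} ^ ?N) \<partial>M)"
  have finP: "finite P" unfolding P_def by (intro finite_SigmaI) auto
  have finJ: "finite (J m)" for m unfolding J_def by (intro finite_SigmaI finP) auto
  have card: "card (?I - {fst p} - snd p) = ?N" if "p \<in> P" for p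
  proof -
    have "snd p \<subseteq> ?I" using that by (auto simp: P_def)
    then have "finite (snd p)" by (rule finite_subset) simp
    then have "card (?I - {fst p} - snd p) = card (?I - {fst p}) - card (snd p)"
      using that by (intro card_Diff_subset) (auto simp: P_def)
    then show ?thesis using that ab by (auto simp: P_def)
  qed
  have sets: "cell ?I h (fst p) (snd p) C \<in> sets (iid_sample ?I)" if "(p, C) \<in> J m" for p C m
    using that by (intro sets_cell) (auto simp: J_def P_def)
  have cell: "measure (iid_sample ?I) (cell ?I h (fst p) (snd p) C) = q ^ card C * (1 - q) ^ (?N - card C) * c"
    if "(p, C) \<in> J m" for p C m
  proof -
    have pC: "p \<in> P" "C \<subseteq> ?I - {fst p} - snd p" using that by (auto simp: J_def)
    then have "emeasure (iid_sample ?I) (cell ?I h (fst p) (snd p) C) =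
     ennreal (q ^ card C * (1 - q) ^ (?N - card C)) *
     (\<integral>\<^sup>+t. ennreal (measure M {..<t} ^ (a - 1) * measure M {t<..} ^ ?N) \<partial>M)"
      using emeasure_cell[of ?I "fst p" "snd p" C ?N h q] q tail h card[OF pC(1)] by (auto simp: P_def)
    then show ?thesis using q by (simp add: measure_def c_def enn2real_mult)
  qed
  have U: "measure (iid_sample ?I) (U m) = real (card P) * c * measure (binomial_pmf ?N q) {..m}" for m
  proof -
    have "measure (iid_sample ?I) (U m) =
        (\<Sum>(p, C)\<in>J m. measure (iid_sample ?I) (cell ?I h (fst p) (snd p) C))"
      unfolding U_def case_prod_beta
    proof (rule P.finite_measure_finite_Union[OF finJ])
      show "(\<lambda>z. cell ?I h (fst (fst z)) (snd (fst z)) (snd z)) ` J m \<subseteq> P.events"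
        using sets by auto
      show "disjoint_family_on (\<lambda>z. cell ?I h (fst (fst z)) (snd (fst z)) (snd z)) (J m)"
        unfolding disjoint_family_on_def
      proof (intro ballI impI equals0I)
        fix z z' x assume z: "z \<in> J m" "z' \<in> J m" "z \<noteq> z'"
          and x: "x \<in> cell ?I h (fst (fst z)) (snd (fst z)) (snd z) \<inter> cell ?I h (fst (fst z')) (snd (fst z')) (snd z')"
        then have "fst (fst z) = fst (fst z') \<and> snd (fst z) = snd (fst z') \<and> snd z = snd z'"
          by (intro disjoint_cell[of ?I _ _ _ _ _ _ x h]) (auto simp: J_def P_def)
        with z(3) show False by (simp add: prod_eq_iff)
      qed
    qed
    also have "\<dots> = (\<Sum>(p, C)\<in>J m. q ^ card C * (1 - q) ^ (?N - card C) * c)"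
      using cell by (intro sum.cong) auto
    also have "\<dots> = (\<Sum>p\<in>P. \<Sum>C | C \<subseteq> ?I - {fst p} - snd p \<and> card C \<le> m. q ^ card C * (1 - q) ^ (?N - card C) * c)"
      unfolding J_def by (subst sum.Sigma) (auto intro: finP)
    also have "\<dots> = (\<Sum>p\<in>P. measure (binomial_pmf ?N q) {..m} * c)"
    proof (rule sum.cong[OF refl])
      fix p assume "p \<in> P"
      then show "(\<Sum>C | C \<subseteq> ?I - {fst p} - snd p \<and> card C \<le> m. q ^ card C * (1 - q) ^ (?N - card C) * c) =
         measure (binomial_pmf ?N q) {..m} * c"
        using sum_subsets_binomial[of "?I - {fst p} - snd p" q m] q
        unfolding card[OF \<open>p \<in> P\<close>] by (simp add: sum_distrib_right[symmetric])
    qed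
    finally show ?thesis by simp
  qed
  have comp: "(\<lambda>x. x j) \<in> borel_measurable (iid_sample ?I)" if "j \<in> ?I" for j
    using that by (auto intro!: measurable_component_singleton[THEN measurable_compose, of _ _ _ "\<lambda>x. x"])
  have tail': "AE x in iid_sample ?I. \<forall>i\<in>?I. x i \<le> h (x i)"
    using tail prob_space_axioms
    by (intro AE_finite_allI) (auto intro!: AE_PiM_component[where P = "\<lambda>t. t \<le> h t"])
  have ties: "AE x in iid_sample ?I. \<forall>i\<in>?I. \<forall>j\<in>?I - {i}. x i \<noteq> x j"
    using atomless by (intro AE_finite_allI AE_iid_sample_neq) auto
  \<comment> \<open>Off the ties, the observation realising the \<open>a\<close>-th order statistic
    is unique, so adding it to the strictly smaller ones raises their number from below
    \<open>a\<close> to at least \<open>a\<close>: there are exactly \<open>a - 1\<close> of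
    them.\<close>
  have AE_cell: "AE x in iid_sample ?I. \<exists>p\<in>P. \<exists>C \<subseteq> ?I - {fst p} - snd p.
      x \<in> cell ?I h (fst p) (snd p) C \<and> x (fst p) \<le> h (x (fst p))"
    using tail' ties AE_space
  proof eventually_elim
    fix x assume h_le: "\<forall>i\<in>?I. x i \<le> h (x i)" and ne: "\<forall>i\<in>?I. \<forall>j\<in>?I - {i}. x i \<noteq> x j"
      and sp: "x \<in> space (iid_sample ?I)"
    obtain i where i: "i \<in> ?I" "order_stat a n x = x i" using order_stat_mem[OF ab(1,2), of x] by blast
    let ?A = "{j\<in>?I. x j < x i}" and ?C = "{j\<in>?I. h (x i) < x j}"
    have le_iff: "x j \<le> x i \<longleftrightarrow> j = i \<or> x j < x i" if "j \<in> ?I" for j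
      using ne i(1) that by (cases "j = i") (auto simp: le_less)
    have "{j\<in>?I. x j \<le> x i} = insert i ?A" using i(1) le_iff by blast
    then have "a \<le> card (insert i ?A)" using order_stat_le_iff[OF ab(1,2), of x "x i"] i by simp
    moreover have "card ?A < a" using card_less_order_stat[OF ab(1,2), of x] i by simp
    ultimately have "card ?A = a - 1" by (simp add: card_insert_if)
    then have "(i, ?A) \<in> P" using i by (auto simp: P_def)
    moreover have "?C \<subseteq> ?I - {i} - ?A" using h_le i(1) by fastforce
    moreover have "x \<in> cell ?I h i ?A ?C" unfolding cell_def
    proof (intro CollectI conjI ballI)
      fix j assume j: "j \<in> ?I - {i} - ?A - ?C"
      then show "x i < x j" "x j \<le> h (x i)" using le_iff[of j] by auto
    next
      fix j assume "j \<in> ?C"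
      then show "x i < x j" "h (x i) < x j" using h_le i(1) by (auto intro: le_less_trans)
    qed (use sp in auto)
    ultimately show "\<exists>p\<in>P. \<exists>C \<subseteq> ?I - {fst p} - snd p.
      x \<in> cell ?I h (fst p) (snd p) C \<and> x (fst p) \<le> h (x (fst p))"
      using h_le i(1) by (intro bexI[of _ "(i, ?A)"] exI[of _ ?C]) auto
  qed
  have AE_U: "AE x in iid_sample ?I. order_stat b n x \<le> h (order_stat a n x) \<longleftrightarrow> x \<in> U (n - b)"
    using AE_cell tail'
  proof eventually_elim
    fix x assume h_le: "\<forall>i\<in>?I. x i \<le> h (x i)"
      and "\<exists>p\<in>P. \<exists>C \<subseteq> ?I - {fst p} - snd p.
      x \<in> cell ?I h (fst p) (snd p) C \<and> x (fst p) \<le> h (x (fst p))"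
    then obtain p C where p: "p \<in> P" "C \<subseteq> ?I - {fst p} - snd p" and x: "x \<in> cell ?I h (fst p) (snd p) C"
      and xp: "x (fst p) \<le> h (x (fst p))" by blast
    have os: "order_stat a n x = x (fst p)" "order_stat b n x \<le> h (x (fst p)) \<longleftrightarrow> card C \<le> n - b"
      using order_stat_on_cell[OF ab _ _ _ _ x xp] p by (auto simp: P_def)
    show "order_stat b n x \<le> h (order_stat a n x) \<longleftrightarrow> x \<in> U (n - b)"
    proof
      assume "order_stat b n x \<le> h (order_stat a n x)"
      then show "x \<in> U (n - b)" using os p x by (auto simp: U_def J_def intro!: bexI[of _ "(p, C)"])
    next
      assume "x \<in> U (n - b)"
      then obtain p' C' where p': "p' \<in> P" "C' \<subseteq> ?I - {fst p'} - snd p'" "card C' \<le> n - b"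
        and x': "x \<in> cell ?I h (fst p') (snd p') C'" by (auto simp: U_def J_def)
      have "order_stat a n x = x (fst p')" "order_stat b n x \<le> h (x (fst p')) \<longleftrightarrow> card C' \<le> n - b"
        using order_stat_on_cell[OF ab _ _ _ _ x'] p' h_le by (auto simp: P_def)
      with p' show "order_stat b n x \<le> h (order_stat a n x)" by simp
    qed
  qed
  have [measurable]: "(\<lambda>x. order_stat a n x) \<in> borel_measurable (iid_sample ?I)"
      "(\<lambda>x. order_stat b n x) \<in> borel_measurable (iid_sample ?I)"
    using borel_measurable_order_stat[OF _ _ comp] ab by auto
  have sets_U: "U m \<in> P.events" for m
    unfolding U_def using sets finJ by (intro sets.finite_UN) auto
  \<comment> \<open>With \<open>m = ?N\<close> the bound on \<open>card C\<close> is vacuous, so the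
    cells exhaust the space; the binomial factor is one as well, which forces
    \<open>card P * c = 1\<close>.\<close>
  have "measure (iid_sample ?I) (U ?N) = 1"
  proof (rule P.prob_eq_1[THEN iffD2, OF sets_U], use AE_cell in eventually_elim)
    fix x assume "\<exists>p\<in>P. \<exists>C \<subseteq> ?I - {fst p} - snd p.
      x \<in> cell ?I h (fst p) (snd p) C \<and> x (fst p) \<le> h (x (fst p))"
    then obtain p C where p: "p \<in> P" "C \<subseteq> ?I - {fst p} - snd p" "x \<in> cell ?I h (fst p) (snd p) C" by blast
    then have "card C \<le> ?N" using card_mono[of "?I - {fst p} - snd p" C] unfolding card[OF p(1)] by simp
    with p show "x \<in> U ?N" by (auto simp: U_def J_def intro!: bexI[of _ "(p, C)"])
  qed
  moreover have "measure (binomial_pmf ?N q) {..?N} = 1"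
    using q by (subst measure_pmf.prob_eq_1) (auto simp: AE_measure_pmf_iff set_pmf_binomial_eq)
  ultimately have "real (card P) * c = 1" using U[of ?N] by simp
  then have "measure (iid_sample ?I) (U (n - b)) = measure (binomial_pmf ?N q) {..n - b}"
    using U[of "n - b"] by simp
  moreover have "{x \<in> space (iid_sample ?I). order_stat b n x \<le> h (order_stat a n x)} \<in> P.events"
    by measurable
  then have "measure (iid_sample ?I) {x \<in> space (iid_sample ?I). order_stat b n x \<le> h (order_stat a n x)} =
      measure (iid_sample ?I) (U (n - b))"
    using AE_U sets_U AE_space by (intro P.finite_measure_eq_AE) auto
  ultimately show ?thesis by simp
qed

end

section \<open>Normal limit of binomial variables with varying success probability\<close>

text \<open>Every trial is centred at its mean, a success contributing 1 - p and a failure - p. The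
  leftover phase comes from recentring n p to \<open>c\<close>, and the binomial theorem collects
  the rest into an \<open>n\<close>-th power.\<close>

lemma char_binomial_affine:
  assumes p: "p \<in> {0..1}"
  shows "char (distr (measure_pmf (binomial_pmf n p)) borel (\<lambda>j. (real j - c) / d)) t =
    iexp (t * (n * p - c) / d) * (of_real (1 - p) * iexp (- (t / d) * p) + of_real p * iexp ((t / d) * (1 - p))) ^ n"
proof -
  let ?B = "measure_pmf (binomial_pmf n p)"
  let ?u = "iexp (- (t / d) * p)"
  have [simp]: "finite (set_pmf (binomial_pmf n p))" using p by auto
  have split: "iexp (t * ((real j - c) / d)) =
      iexp (t * (n * p - c) / d) * (iexp ((t / d) * (1 - p)) ^ j * ?u ^ (n - j))" if "j \<le> n" for j
    using that unfolding exp_of_nat_mult[symmetric] exp_add[symmetric]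
    by (intro arg_cong[where f = exp]) (simp add: of_nat_diff field_simps add_divide_distrib diff_divide_distrib)
  have "char (distr ?B borel (\<lambda>j. (real j - c) / d)) t = (\<integral>j. iexp (t * ((real j - c) / d)) \<partial>?B)"
    unfolding char_def by (subst integral_distr) auto
  also have "\<dots> = (\<Sum>j\<le>n. pmf (binomial_pmf n p) j *\<^sub>R iexp (t * ((real j - c) / d)))"
    using p by (intro integral_measure_pmf) (auto simp: set_pmf_binomial_eq split: if_splits)
  also have "\<dots> = iexp (t * (n * p - c) / d) *
      (\<Sum>j\<le>n. of_nat (n choose j) * (of_real p * iexp ((t / d) * (1 - p))) ^ j * (of_real (1 - p) * ?u) ^ (n - j))"
    unfolding sum_distrib_left
  proof (rule sum.cong[OF refl])
    fix j assume "j \<in> {..n}"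
    then have "j \<le> n" by simp
    show "pmf (binomial_pmf n p) j *\<^sub>R iexp (t * ((real j - c) / d)) = iexp (t * (n * p - c) / d) *
      (of_nat (n choose j) * (of_real p * iexp ((t / d) * (1 - p))) ^ j * (of_real (1 - p) * ?u) ^ (n - j))"
      unfolding split[OF \<open>j \<le> n\<close>] using p by (simp add: scaleR_conv_of_real power_mult_distrib mult_ac)
  qed
  also have "(\<Sum>j\<le>n. of_nat (n choose j) * (of_real p * iexp ((t / d) * (1 - p))) ^ j * (of_real (1 - p) * ?u) ^ (n - j)) =
     (of_real p * iexp ((t / d) * (1 - p)) + of_real (1 - p) * ?u) ^ n"
    by (simp add: binomial_ring)
  finally show ?thesis by (simp add: add.commute)
qed

text \<open>Second-order Taylor expansion: the linear terms cancel by centring, the quadratic ones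
  add up to the variance p (1 - p), and both arguments are at most |u| in absolute value. The error
  bound is free of \<open>p\<close>, as a triangular array demands.\<close>

lemma cmod_char_centered_bernoulli_approx:
  fixes p u :: real
  assumes p: "p \<in> {0..1}"
  defines "\<phi> \<equiv> of_real (1 - p) * iexp (- u * p) + of_real p * iexp (u * (1 - p))"
  shows "cmod \<phi> \<le> 1"
    and "cmod (\<phi> - of_real (1 - u\<^sup>2 * (p * (1 - p)) / 2)) \<le> \<bar>u\<bar> ^ 3 / 6"
proof -
  have "cmod \<phi> \<le> cmod (of_real (1 - p) * iexp (- u * p)) + cmod (of_real p * iexp (u * (1 - p)))"
    unfolding \<phi>_def by (rule norm_triangle_ineq)
  also have "\<dots> = 1" using p by (simp add: norm_mult del: of_real_mult of_real_diff of_real_minus)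
  finally show "cmod \<phi> \<le> 1" .
  define e where "e x = iexp x - (1 + \<i> * x - x\<^sup>2 / 2)" for x :: real
  have e: "cmod (e x) \<le> \<bar>x\<bar> ^ 3 / 6" for x
    using iexp_approx1[of x 2] by (simp add: e_def numeral_2_eq_2 numeral_3_eq_3 power2_eq_square algebra_simps)
  have iexp_eq: "iexp x = e x + (1 + \<i> * x - x\<^sup>2 / 2)" for x by (simp add: e_def)
  have "\<phi> - of_real (1 - u\<^sup>2 * (p * (1 - p)) / 2) =
     of_real (1 - p) * e (- u * p) + of_real p * e (u * (1 - p))"
    unfolding \<phi>_def iexp_eq by (simp add: power2_eq_square algebra_simps) (simp add: field_simps)
  also have "cmod \<dots> \<le> (1 - p) * cmod (e (- u * p)) + p * cmod (e (u * (1 - p)))"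
    using p by (intro order_trans[OF norm_triangle_ineq]) (simp add: norm_mult del: of_real_diff)
  also have "\<dots> \<le> (1 - p) * (\<bar>u\<bar> ^ 3 / 6) + p * (\<bar>u\<bar> ^ 3 / 6)"
  proof (intro add_mono mult_left_mono)
    have "\<bar>- u * p\<bar> \<le> \<bar>u\<bar>" "\<bar>u * (1 - p)\<bar> \<le> \<bar>u\<bar>" using p by (auto simp: abs_mult intro!: mult_left_le)
    then have "\<bar>- u * p\<bar> ^ 3 \<le> \<bar>u\<bar> ^ 3" "\<bar>u * (1 - p)\<bar> ^ 3 \<le> \<bar>u\<bar> ^ 3" by (auto intro!: power_mono)
    then show "cmod (e (- u * p)) \<le> \<bar>u\<bar> ^ 3 / 6" "cmod (e (u * (1 - p))) \<le> \<bar>u\<bar> ^ 3 / 6"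
      using e[of "- u * p"] e[of "u * (1 - p)"] by linarith+
  qed (use p in auto)
  also have "\<dots> = \<bar>u\<bar> ^ 3 / 6" by (simp add: distrib_right[symmetric])
  finally show "cmod (\<phi> - of_real (1 - u\<^sup>2 * (p * (1 - p)) / 2)) \<le> \<bar>u\<bar> ^ 3 / 6" .
qed

text \<open>The centring \<open>c\<close> may differ from the mean; its distance from the mean, in
  standard deviations, survives as the translation \<open>v\<close>. Since |a^n - b^n| \<le> n |a -
  b| in the unit disc, the cubic Taylor error contributes n / d^3, which is of order 1 / sqrt
  n.\<close>

lemma weak_conv_binomial:
  fixes n :: "nat \<Rightarrow> nat" and p c :: "nat \<Rightarrow> real"
  defines "d \<equiv> \<lambda>k. sqrt (n k * (p k * (1 - p k)))"
  assumes n: "filterlim n at_top sequentially"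
    and p: "p \<longlonglongrightarrow> p\<^sub>0" "0 < p\<^sub>0" "p\<^sub>0 < 1"
    and shift: "(\<lambda>k. (n k * p k - c k) / d k) \<longlonglongrightarrow> v"
  shows "weak_conv_m (\<lambda>k. distr (measure_pmf (binomial_pmf (n k) (p k))) borel (\<lambda>j. (real j - c k) / d k))
    (distr std_normal_distribution borel (\<lambda>x. x + v))"
proof (rule levy_continuity)
  interpret N: real_distribution std_normal_distribution by (rule real_dist_normal_dist)
  show "real_distribution (distr (measure_pmf (binomial_pmf (n k) (p k))) borel (\<lambda>j. (real j - c k) / d k))" for k
    by (intro prob_space.real_distribution_distr prob_space_measure_pmf) simp
  show "real_distribution (distr std_normal_distribution borel (\<lambda>x. x + v))"
    by (intro N.real_distribution_distr) simp
  fix t :: real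
  define \<phi> where "\<phi> k = of_real (1 - p k) * iexp (- (t / d k) * p k) + of_real (p k) * iexp ((t / d k) * (1 - p k))" for k
  \<comment> \<open>Because d^2 = n p (1 - p), this is exactly the quadratic approximation of
    \<open>\<phi> k\<close> at the argument \<open>t / d k\<close>.\<close>
  define w where "w k = 1 + (- (t\<^sup>2) / 2) / n k" for k
  have n_real: "filterlim (\<lambda>k. real (n k)) at_top sequentially"
    using filterlim_compose[OF filterlim_real_sequentially n] .
  then have n_ev: "eventually (\<lambda>k. real (n k) \<ge> C) sequentially" for C
    by (auto simp: filterlim_at_top)
  have p_ev: "eventually (\<lambda>k. 0 < p k) sequentially" "eventually (\<lambda>k. p k < 1) sequentially"
    using p by (auto dest: order_tendstoD)
  have "(\<lambda>k. w k ^ n k) \<longlonglongrightarrow> exp (- (t\<^sup>2) / 2)"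
    using filterlim_compose[OF tendsto_exp_limit_sequentially[of "- (t\<^sup>2) / 2"] n] unfolding w_def .
  then have w: "(\<lambda>k. complex_of_real (w k) ^ n k) \<longlonglongrightarrow> of_real (exp (- (t\<^sup>2) / 2))"
    unfolding of_real_power[symmetric] by (rule tendsto_of_real)
  have "(\<lambda>k. \<phi> k ^ n k - complex_of_real (w k) ^ n k) \<longlonglongrightarrow> 0"
  proof (rule Lim_null_comparison)
    show "eventually (\<lambda>k. cmod (\<phi> k ^ n k - complex_of_real (w k) ^ n k) \<le>
        \<bar>t\<bar> ^ 3 / 6 / (sqrt (n k) * sqrt (p k * (1 - p k)) ^ 3)) sequentially"
      \<comment> \<open>The threshold \<open>t\<^sup>2 / 4\<close> is what
        \<open>-1 \<le> w k\<close> amounts to, so that \<open>w k\<close> stays in the unit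
        disc.\<close>
      using n_ev[of 1] n_ev[of "t\<^sup>2 / 4"] p_ev
    proof eventually_elim
      case (elim k)
      then have pk: "p k \<in> {0..1}" and n0: "real (n k) > 0" by auto
      have "-1 \<le> w k" "w k \<le> 1" using elim n0 by (auto simp: w_def divide_simps)
      then have "cmod (complex_of_real (w k)) \<le> 1" by simp
      then have "cmod (\<phi> k ^ n k - complex_of_real (w k) ^ n k) \<le> n k * cmod (\<phi> k - complex_of_real (w k))"
        using cmod_char_centered_bernoulli_approx(1)[OF pk, of "t / d k"]
        by (intro norm_power_diff) (auto simp: \<phi>_def)
      also have "\<dots> \<le> n k * (\<bar>t / d k\<bar> ^ 3 / 6)"
      proof (rule mult_left_mono)
        have w_eq: "w k = 1 - (t / d k)\<^sup>2 * (p k * (1 - p k)) / 2"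
          using elim by (simp add: w_def d_def power_divide)
        show "cmod (\<phi> k - complex_of_real (w k)) \<le> \<bar>t / d k\<bar> ^ 3 / 6"
          unfolding \<phi>_def w_eq by (rule cmod_char_centered_bernoulli_approx(2)[OF pk])
      qed simp
      also have "n k * (\<bar>t / d k\<bar> ^ 3 / 6) = \<bar>t\<bar> ^ 3 / 6 / (sqrt (n k) * sqrt (p k * (1 - p k)) ^ 3)"
      proof -
        have "\<bar>d k\<bar> ^ 3 = n k * (sqrt (n k) * sqrt (p k * (1 - p k)) ^ 3)"
          using elim by (simp add: d_def real_sqrt_mult power_mult_distrib power3_eq_cube)
        then show ?thesis using n0 by (simp add: power_divide)
      qed
      finally show ?case .
    qed
    have "filterlim (\<lambda>k. sqrt (n k) * sqrt (p k * (1 - p k)) ^ 3) at_top sequentially"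
    proof (rule filterlim_at_top_mult_tendsto_pos)
      show "(\<lambda>k. sqrt (p k * (1 - p k)) ^ 3) \<longlonglongrightarrow> sqrt (p\<^sub>0 * (1 - p\<^sub>0)) ^ 3"
        by (intro tendsto_intros p)
      show "filterlim (\<lambda>k. sqrt (n k)) at_top sequentially"
        by (rule filterlim_compose[OF sqrt_at_top n_real])
    qed (use p in simp)
    then show "(\<lambda>k. \<bar>t\<bar> ^ 3 / 6 / (sqrt (n k) * sqrt (p k * (1 - p k)) ^ 3)) \<longlonglongrightarrow> 0"
      by (intro tendsto_divide_0[OF tendsto_const] filterlim_at_top_imp_at_infinity)
  qed
  from tendsto_add[OF this w] have "(\<lambda>k. \<phi> k ^ n k) \<longlonglongrightarrow> of_real (exp (- (t\<^sup>2) / 2))" by simp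
  moreover have "(\<lambda>k. iexp (t * ((n k * p k - c k) / d k))) \<longlonglongrightarrow> iexp (t * v)"
    by (intro tendsto_intros shift)
  ultimately have "(\<lambda>k. iexp (t * ((n k * p k - c k) / d k)) * \<phi> k ^ n k) \<longlonglongrightarrow>
     iexp (t * v) * of_real (exp (- (t\<^sup>2) / 2))" by (intro tendsto_mult)
  moreover have "eventually (\<lambda>k. iexp (t * ((n k * p k - c k) / d k)) * \<phi> k ^ n k =
      char (distr (measure_pmf (binomial_pmf (n k) (p k))) borel (\<lambda>j. (real j - c k) / d k)) t) sequentially"
    using p_ev by eventually_elim (subst char_binomial_affine, auto simp: \<phi>_def)
  moreover have "char (distr std_normal_distribution borel (\<lambda>x. x + v)) t = iexp (t * v) * of_real (exp (- (t\<^sup>2) / 2))"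
  proof -
    have "char (distr std_normal_distribution borel (\<lambda>x. x + v)) t = (\<integral>x. iexp (t * (x + v)) \<partial>std_normal_distribution)"
      unfolding char_def by (subst integral_distr) auto
    also have "\<dots> = (\<integral>x. iexp (t * v) * iexp (t * x) \<partial>std_normal_distribution)"
      unfolding exp_add[symmetric] by (simp add: algebra_simps)
    also have "\<dots> = iexp (t * v) * char std_normal_distribution t"
      unfolding char_def by (rule integral_mult_right_zero)
    finally show ?thesis by (simp add: char_std_normal_distribution)
  qed
  ultimately show "(\<lambda>k. char (distr (measure_pmf (binomial_pmf (n k) (p k))) borel (\<lambda>j. (real j - c k) / d k)) t)
      \<longlonglongrightarrow> char (distr std_normal_distribution borel (\<lambda>x. x + v)) t"
    by (simp only: Lim_transform_eventually)
qed

section \<open>The standard normal distribution and its quantiles\<close>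

lemma std_normal_atomless: "measure std_normal_distribution {x} = 0"
proof -
  interpret N: real_distribution std_normal_distribution by (rule real_dist_normal_dist)
  have "AE y in std_normal_distribution. y \<noteq> x"
    using AE_lborel_singleton[of x] by (subst AE_density) auto
  then show ?thesis by (subst N.prob_eq_0) auto
qed

lemma isCont_cdf_std_normal: "isCont (cdf std_normal_distribution) x"
  by (subst finite_borel_measure.isCont_cdf[OF real_distribution.finite_borel_measure_M[OF real_dist_normal_dist]])
    (rule std_normal_atomless)

text \<open>The characteristic function of the standard normal law is even, and it determines the
  law.\<close>

lemma distr_uminus_std_normal: "distr std_normal_distribution borel uminus = std_normal_distribution"
proof (rule Levy_uniqueness)
  interpret N: real_distribution std_normal_distribution by (rule real_dist_normal_dist)
  show "real_distribution (distr std_normal_distribution borel uminus)" by (rule N.real_distribution_distr) simp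
  show "real_distribution std_normal_distribution" by (rule real_dist_normal_dist)
  have "char (distr std_normal_distribution borel uminus) t = char std_normal_distribution (- t)" for t
    unfolding char_def by (subst integral_distr) auto
  then show "char (distr std_normal_distribution borel uminus) = char std_normal_distribution"
    by (simp add: fun_eq_iff char_std_normal_distribution)
qed

lemma cdf_std_normal_minus: "cdf std_normal_distribution (- x) = 1 - cdf std_normal_distribution x"
proof -
  interpret N: real_distribution std_normal_distribution by (rule real_dist_normal_dist)
  have "cdf std_normal_distribution (- x) = measure (distr std_normal_distribution borel uminus) {..- x}"
    by (simp add: distr_uminus_std_normal cdf_def)
  also have "\<dots> = N.prob {x..}"
    by (subst measure_distr) (auto intro!: arg_cong[where f = N.prob])
  also have "\<dots> = 1 - N.prob {..<x}"
    by (subst N.prob_compl[symmetric]) (auto intro!: arg_cong[where f = N.prob])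
  also have "N.prob {..<x} = N.prob {..<x} + N.prob {x}" by (simp add: std_normal_atomless)
  also have "\<dots> = cdf std_normal_distribution x"
    unfolding cdf_def by (subst N.finite_measure_Union[symmetric]) (auto intro!: arg_cong[where f = N.prob])
  finally show ?thesis .
qed

text \<open>Continuity makes the set in \<open>quantile\<close> closed, so its infimum belongs to
  it. The intermediate value theorem yields a point with value exactly \<open>p\<close> no larger
  than the infimum; it lies in the set as well, hence equals the infimum.\<close>

lemma (in real_distribution) cdf_quantile:
  assumes cont: "\<And>x. isCont (cdf M) x" and p: "0 < p" "p < 1"
  shows "cdf M (quantile M p) = p"
proof -
  let ?S = "{x. p \<le> cdf M x}"
  have "eventually (\<lambda>x. cdf M x < p) at_bot" by (rule order_tendstoD(2)[OF cdf_lim_at_bot p(1)])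
  then obtain a where a: "cdf M a < p" by (auto simp: eventually_at_bot_linorder)
  have "eventually (\<lambda>x. p < cdf M x) at_top" by (rule order_tendstoD(1)[OF cdf_lim_at_top_prob p(2)])
  then obtain b where b: "p < cdf M b" by (auto simp: eventually_at_top_linorder)
  have lower: "a \<le> x" if "x \<in> ?S" for x using that a cdf_nondecreasing[of x a] by (cases "a \<le> x") auto
  then have bdd: "bdd_below ?S" by (auto simp: bdd_below_def)
  have "closed ?S"
    by (intro closed_Collect_le continuous_on_const continuous_at_imp_continuous_on ballI cont)
  then have mem: "quantile M p \<in> ?S"
    unfolding quantile_def using bdd b by (intro closed_contains_Inf) (auto intro: less_imp_le)
  have "a \<le> quantile M p" using lower mem by blast
  then obtain x where x: "x \<le> quantile M p" "cdf M x = p"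
    using IVT[of "cdf M" a p "quantile M p"] a mem cont by auto
  then have "quantile M p \<le> x" unfolding quantile_def using bdd by (intro cInf_lower) auto
  with x show ?thesis by simp
qed

lemma prob_std_normal_symmetric_interval:
  assumes "0 < a" "a < 1"
  defines "z \<equiv> quantile std_normal_distribution (1 - a / 2)"
  shows "measure std_normal_distribution {- z..z} = 1 - a"
proof -
  interpret N: real_distribution std_normal_distribution by (rule real_dist_normal_dist)
  have z: "cdf std_normal_distribution z = 1 - a / 2"
    unfolding z_def using assms by (intro N.cdf_quantile isCont_cdf_std_normal) auto
  then have z': "cdf std_normal_distribution (- z) = a / 2" by (simp add: cdf_std_normal_minus)
  have "- z < z"
  proof (rule ccontr)
    assume "\<not> - z < z"
    then have "cdf std_normal_distribution z \<le> cdf std_normal_distribution (- z)"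
      by (intro N.cdf_nondecreasing) simp
    with z z' assms show False by simp
  qed
  then have "measure std_normal_distribution {- z..z} = N.prob {- z} + N.prob {- z<..z}"
    by (subst N.finite_measure_Union[symmetric]) (auto intro!: arg_cong[where f = N.prob])
  also have "\<dots> = 1 - a"
    using \<open>- z < z\<close> z z' by (simp add: std_normal_atomless N.cdf_diff_eq[symmetric])
  finally show ?thesis .
qed

section \<open>Pareto samples\<close>

text \<open>The non-random factor of \<open>ci_halfwidth\<close>; it is the asymptotic standard
  deviation of \<alpha> times \<open>log_ratio\<close>.\<close>

definition ratio_scale :: "nat \<Rightarrow> nat \<Rightarrow> real" where
  "ratio_scale k s = sqrt ((real s ^ 2 - 1) / (real s * (real k * (real s + 1) - 1)))"

lemma ratio_scale_pos:
  assumes "k \<ge> 1" "s \<ge> 2"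
  shows "ratio_scale k s > 0"
proof -
  have "real k * real s > 0" "real k \<ge> 1" using assms by auto
  then have "real k * (real s + 1) - 1 > 0" by (simp add: distrib_left)
  moreover have "real s ^ 2 > 1" using assms by (simp add: one_less_power)
  ultimately show ?thesis
    unfolding ratio_scale_def using assms by (intro real_sqrt_gt_zero divide_pos_pos mult_pos_pos) auto
qed

text \<open>The factor s + 1 of s^2 - 1 cancels against k (s + 1) - 1, which grows like k (s + 1).
  The limit agrees with the binomial standard deviation divided by sqrt k, since s (1 / s) (1 - 1 /
  s) = (s - 1) / s.\<close>

lemma sqrt_mult_ratio_scale_limit:
  assumes "s \<ge> 2"
  shows "(\<lambda>k. sqrt k * ratio_scale k s) \<longlonglongrightarrow> sqrt ((real s - 1) / s)"
proof -
  have "(\<lambda>k. sqrt ((real s ^ 2 - 1) / (real s * (real s + 1 - 1 / real k)))) \<longlonglongrightarrow>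
      sqrt ((real s ^ 2 - 1) / (real s * (real s + 1 - 0)))"
    using assms by (intro tendsto_intros lim_1_over_n) auto
  also have "(real s ^ 2 - 1) / (real s * (real s + 1 - 0)) = (real s - 1) / s"
  proof (subst frac_eq_eq)
    have "real s + 1 > 0" by (rule add_nonneg_pos) auto
    then show "real s * (real s + 1 - 0) \<noteq> 0" using assms by simp
  qed (use assms in \<open>auto simp: algebra_simps power2_eq_square\<close>)
  finally have *: "(\<lambda>k. sqrt ((real s ^ 2 - 1) / (real s * (real s + 1 - 1 / real k)))) \<longlonglongrightarrow> sqrt ((real s - 1) / s)" .
  show ?thesis
  proof (rule Lim_transform_eventually[OF * eventually_mono[OF eventually_gt_at_top[of 0]]])
    fix k :: nat assume "0 < k"
    then have "real s * (real s + 1 - 1 / real k) = real s * (real k * (real s + 1) - 1) / k"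
      by (simp add: field_simps)
    then show "sqrt ((real s ^ 2 - 1) / (real s * (real s + 1 - 1 / real k))) = sqrt k * ratio_scale k s"
      unfolding ratio_scale_def real_sqrt_mult[symmetric] by (simp add: mult_ac)
  qed
qed

lemma ratio_scale_limit:
  assumes "s \<ge> 2"
  shows "(\<lambda>k. ratio_scale k s) \<longlonglongrightarrow> 0"
proof -
  have "filterlim (\<lambda>k. sqrt (real k)) at_top sequentially"
    by (rule filterlim_compose[OF sqrt_at_top filterlim_real_sequentially])
  then have "(\<lambda>k. sqrt k * ratio_scale k s / sqrt k) \<longlonglongrightarrow> 0"
    by (intro tendsto_divide_0[OF sqrt_mult_ratio_scale_limit[OF assms]] filterlim_at_top_imp_at_infinity)
  then show ?thesis
    by (rule Lim_transform_eventually) (intro eventually_mono[OF eventually_gt_at_top[of 0]], auto)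
qed

text \<open>The variable is centred at the threshold \<open>k - 1\<close> rather than at its mean.
  The event then becomes \<open>{..0}\<close> for all large \<open>k\<close>, the drift - u moves
  into the limit law \<open>\<nu>\<close>, and evaluating at the fixed continuity point 0
  suffices.\<close>

lemma binomial_tail_limit:
  assumes s: "s \<ge> 2"
  shows "(\<lambda>k. measure (binomial_pmf (k * s - 1) (exp (- (ln (real s) + u * ratio_scale k s)))) {..k - 1})
    \<longlonglongrightarrow> cdf std_normal_distribution u"
proof -
  interpret N: real_distribution std_normal_distribution by (rule real_dist_normal_dist)
  define q where "q k = exp (- (ln (real s) + u * ratio_scale k s))" for k
  define d where "d k = sqrt (real (k * s - 1) * (q k * (1 - q k)))" for k
  define g where "g = sqrt ((real s - 1) / s)"
  define \<nu> where "\<nu> = distr std_normal_distribution borel (\<lambda>x. x + - u)"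
  have g: "g > 0" using s by (simp add: g_def)
  have "(\<lambda>k. exp (- (ln (real s) + u * ratio_scale k s))) \<longlonglongrightarrow> exp (- (ln (real s) + u * 0))"
    by (intro tendsto_intros ratio_scale_limit s)
  then have q: "q \<longlonglongrightarrow> 1 / s" using s by (simp add: q_def[abs_def] exp_minus inverse_eq_divide)
  have sk: "real (k * s - 1) = real k * s - 1" if "k \<ge> 1" for k
  proof -
    have "k * s \<ge> 1" using that s by (simp add: Suc_leI)
    then show ?thesis by (simp add: of_nat_diff)
  qed
  have n: "filterlim (\<lambda>k. k * s - 1) at_top sequentially"
  proof (rule filterlim_at_top_mono[OF filterlim_ident])
    show "eventually (\<lambda>k. k \<le> k * s - 1) sequentially"
      using eventually_ge_at_top[of 1]
    proof eventually_elim
      case (elim k)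
      have "k * 2 \<le> k * s" using s by simp
      with elim show ?case by linarith
    qed
  qed
  have shift: "(\<lambda>k. (real (k * s - 1) * q k - real (k - 1)) / d k) \<longlonglongrightarrow> - u"
  proof -
    \<comment> \<open>The difference quotient extended continuously by 1, so that
      \<open>1 - exp (- x) = x * \<phi> x\<close> also covers \<open>u = 0\<close>.\<close>
    define \<phi> where "\<phi> x = (if x = 0 then 1 else (1 - exp (- x)) / x)" for x :: real
    have "((\<lambda>x. (1 - exp (- x)) / x) \<longlongrightarrow> (1::real)) (at 0)"
    proof -
      have "((\<lambda>x. 1 - exp (- x)) has_field_derivative (1::real)) (at 0)"
        by (auto intro!: derivative_eq_intros)
      then show ?thesis by (simp add: has_field_derivative_iff)
    qed
    then have "\<phi> \<midarrow>0\<rightarrow> 1"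
      by (rule Lim_transform_eventually) (auto simp: \<phi>_def eventually_at_filter)
    then have "isCont \<phi> 0" by (simp add: isCont_def \<phi>_def[of 0])
    moreover have "(\<lambda>k. u * ratio_scale k s) \<longlonglongrightarrow> 0"
      using tendsto_mult_left[OF ratio_scale_limit[OF s], of u] by simp
    ultimately have \<phi>: "(\<lambda>k. \<phi> (u * ratio_scale k s)) \<longlonglongrightarrow> 1"
      using isCont_tendsto_compose[of 0 \<phi>] by (fastforce simp: \<phi>_def)
    have inv_sqrt: "(\<lambda>k. 1 / sqrt (real k)) \<longlonglongrightarrow> 0"
      by (intro tendsto_divide_0[OF tendsto_const] filterlim_at_top_imp_at_infinity
          filterlim_compose[OF sqrt_at_top filterlim_real_sequentially])
    \<comment> \<open>Numerator and denominator of \<open>shift\<close> divided by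
      \<open>sqrt k\<close>. The term with \<open>1 - q k\<close> is the effect of the two
      subtractions of one: (k s - 1) q - (k - 1) = k (s q - 1) + (1 - q).\<close>
    have "(\<lambda>k. (- u * (sqrt k * ratio_scale k s) * \<phi> (u * ratio_scale k s) + (1 - q k) * (1 / sqrt k)) /
        sqrt ((real s - 1 / k) * (q k * (1 - q k)))) \<longlonglongrightarrow>
        (- u * g * 1 + (1 - 1 / s) * 0) / sqrt ((real s - 0) * (1 / s * (1 - 1 / s)))"
      using s by (intro tendsto_intros sqrt_mult_ratio_scale_limit[OF s, folded g_def] \<phi> q lim_1_over_n inv_sqrt) auto
    also have "(real s - 0) * (1 / s * (1 - 1 / s)) = (real s - 1) / s" using s by (simp add: field_simps)
    also have "(- u * g * 1 + (1 - 1 / s) * 0) / sqrt ((real s - 1) / s) = - u"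
      using g unfolding g_def[symmetric] by simp
    finally show ?thesis
    proof (rule Lim_transform_eventually, intro eventually_mono[OF eventually_ge_at_top[of 1]])
      fix k :: nat assume k: "1 \<le> k"
      let ?x = "u * ratio_scale k s"
      have "s * q k = exp (- ?x)" using s by (simp add: q_def exp_diff exp_minus divide_inverse)
      moreover have "1 - exp (- ?x) = ?x * \<phi> ?x" by (simp add: \<phi>_def)
      ultimately have "s * q k = 1 - ?x * \<phi> ?x" by simp
      have "sqrt k * (- u * (sqrt k * ratio_scale k s) * \<phi> ?x + (1 - q k) * (1 / sqrt k)) =
          (sqrt k * sqrt k) * (- ?x * \<phi> ?x) + (1 - q k) * (sqrt k / sqrt k)"
        by (simp only: distrib_left) (simp add: mult_ac)
      also have "\<dots> = k * (- ?x * \<phi> ?x) + (1 - q k)" using k by simp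
      also have "\<dots> = k * (s * q k - 1) + (1 - q k)" unfolding \<open>s * q k = 1 - ?x * \<phi> ?x\<close> by simp
      also have "\<dots> = real (k * s - 1) * q k - real (k - 1)"
        unfolding sk[OF k] using k by (simp add: of_nat_diff algebra_simps)
      finally have num: "real (k * s - 1) * q k - real (k - 1) = sqrt k *
          (- u * (sqrt k * ratio_scale k s) * \<phi> ?x + (1 - q k) * (1 / sqrt k))" ..
      have den: "real (k * s - 1) * (q k * (1 - q k)) = real k * ((real s - 1 / k) * (q k * (1 - q k)))"
        unfolding sk[OF k] using k by (simp add: field_simps)
      have "d k = sqrt k * sqrt ((real s - 1 / k) * (q k * (1 - q k)))"
        unfolding d_def den by (rule real_sqrt_mult)
      with num k show "(- u * (sqrt k * ratio_scale k s) * \<phi> ?x + (1 - q k) * (1 / sqrt k)) /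
        sqrt ((real s - 1 / k) * (q k * (1 - q k))) = (real (k * s - 1) * q k - real (k - 1)) / d k"
        by simp
    qed
  qed
  have "weak_conv_m (\<lambda>k. distr (measure_pmf (binomial_pmf (k * s - 1) (q k))) borel (\<lambda>j. (real j - real (k - 1)) / d k)) \<nu>"
    unfolding d_def \<nu>_def by (rule weak_conv_binomial[OF n q _ _ shift[unfolded d_def]]) (use s in auto)
  moreover have "isCont (cdf \<nu>) 0"
  proof -
    interpret \<nu>: real_distribution \<nu> unfolding \<nu>_def by (rule N.real_distribution_distr) simp
    have "measure \<nu> {0} = N.prob {u}"
      unfolding \<nu>_def by (subst measure_distr) (auto intro!: arg_cong[where f = N.prob])
    then show ?thesis by (simp add: \<nu>.isCont_cdf std_normal_atomless)
  qed
  ultimately have "(\<lambda>k. cdf (distr (measure_pmf (binomial_pmf (k * s - 1) (q k))) borel (\<lambda>j. (real j - real (k - 1)) / d k)) 0)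
      \<longlonglongrightarrow> cdf \<nu> 0"
    by (simp add: weak_conv_m_def weak_conv_def)
  moreover have "cdf \<nu> 0 = cdf std_normal_distribution u"
    unfolding \<nu>_def cdf_def by (subst measure_distr) (auto intro!: arg_cong[where f = N.prob])
  moreover have "eventually (\<lambda>k. cdf (distr (measure_pmf (binomial_pmf (k * s - 1) (q k))) borel (\<lambda>j. (real j - real (k - 1)) / d k)) 0
      = measure (binomial_pmf (k * s - 1) (q k)) {..k - 1}) sequentially"
  proof -
    \<comment> \<open>Dividing by \<open>d k\<close> preserves the inequality only if
      \<open>d k > 0\<close>; for negative \<open>u\<close> and small \<open>k\<close>,
      \<open>q k\<close> may reach 1.\<close>
    have "eventually (\<lambda>k. q k < 1) sequentially" using s by (intro order_tendstoD[OF q]) auto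
    then show ?thesis using eventually_ge_at_top[of 1]
    proof eventually_elim
      case (elim k)
      have "k * s \<ge> k * 2" using s by simp
      with elim have "k * s - 1 > 0" by linarith
      then have "d k > 0" using elim unfolding d_def by (auto simp: q_def)
      then show ?case
        unfolding cdf_def by (subst measure_distr) (auto intro!: arg_cong[where f = "measure _"] simp: divide_le_0_iff)
    qed
  qed
  ultimately show ?thesis unfolding q_def[symmetric] by (simp only: Lim_transform_eventually)
qed

section \<open>Exact law of the log ratio of a Pareto sample\<close>

lemma order_stat_restrict: "order_stat i n (restrict x {1..n}) = order_stat i n x"
proof -
  have "map (restrict x {1..n}) [1..<Suc n] = map x [1..<Suc n]"
    by (rule map_cong) auto
  then show ?thesis by (simp only: order_stat_def)
qed

text \<open>Expressing the case distinction by \<open>max\<close> makes continuity at \<delta> a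
  matter of composition.\<close>

lemma pareto_cdf_eq:
  assumes "\<alpha> > 0" "\<delta> > 0"
  shows "pareto_cdf \<alpha> \<delta> x = 1 - (\<delta> / max \<delta> x) powr \<alpha>"
  using assms by (simp add: pareto_cdf_def max_def)

lemma isCont_pareto_cdf:
  assumes "\<alpha> > 0" "\<delta> > 0"
  shows "isCont (pareto_cdf \<alpha> \<delta>) x"
proof -
  have "isCont (\<lambda>x. 1 - (\<delta> / max \<delta> x) powr \<alpha>) x"
    using assms by (intro continuous_intros) (auto simp: max_def)
  then show ?thesis using pareto_cdf_eq[OF assms] by presburger
qed

text \<open>Apply \<open>prob_order_stat_le\<close> to \<open>h t = exp y * t\<close>, the
  multiplicative form of memorylessness, with ranks \<open>a = k\<close> and
  \<open>b = k * s\<close>; then \<open>n - a = k * s - 1\<close> and \<open>n - b = k - 1\<close>.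
  The condition \<open>y \<ge> 0\<close> ensures \<open>t \<le> h t\<close>.\<close>

lemma (in prob_space) prob_log_ratio_le:
  fixes X :: "nat \<Rightarrow> 'a \<Rightarrow> real"
  assumes \<alpha>\<delta>: "\<alpha> > 0" "\<delta> > 0" and ks: "k \<ge> 1" "s \<ge> 1" and y: "y \<ge> 0"
    and indep: "indep_vars (\<lambda>_. borel) X {1..k * (s + 1) - 1}"
    and pareto: "\<And>i. i \<in> {1..k * (s + 1) - 1} \<Longrightarrow> pareto_rv M (X i) \<alpha> \<delta>"
  shows "(\<lambda>\<omega>. log_ratio k s (\<lambda>i. X i \<omega>)) \<in> borel_measurable M"
    and "prob {\<omega> \<in> space M. log_ratio k s (\<lambda>i. X i \<omega>) \<le> y} =
      measure (binomial_pmf (k * s - 1) (exp (- \<alpha> * y))) {..k - 1}"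
proof -
  define n where "n = k * (s + 1) - 1"
  have n_eq: "(s + 1) * k - 1 = n" by (simp add: n_def mult.commute)
  have kks: "k \<le> k * s" using ks by simp
  have "k * (s + 1) = k * s + k" by simp
  with kks ks have nk: "1 \<le> k" "k \<le> n" "1 \<le> k * s" "k * s \<le> n" "n - k = k * s - 1" "n - k * s = k - 1"
    unfolding n_def by linarith+
  have meas[measurable]: "X i \<in> borel_measurable M" if "i \<in> {1..n}" for i
    using pareto that by (auto simp: pareto_rv_def n_def)
  have [measurable]: "(\<lambda>\<omega>. order_stat k n (\<lambda>i. X i \<omega>)) \<in> borel_measurable M"
      "(\<lambda>\<omega>. order_stat (k * s) n (\<lambda>i. X i \<omega>)) \<in> borel_measurable M"
    using nk meas by (auto intro!: borel_measurable_order_stat)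
  show "(\<lambda>\<omega>. log_ratio k s (\<lambda>i. X i \<omega>)) \<in> borel_measurable M"
    unfolding log_ratio_def n_eq by measurable
  define D where "D = distr M borel (X 1)"
  interpret D: real_distribution D
    unfolding D_def using nk by (intro real_distribution_distr meas) auto
  have cdf: "cdf (distr M borel (X i)) = pareto_cdf \<alpha> \<delta>" if "i \<in> {1..n}" for i
    using pareto that by (auto simp: pareto_rv_def n_def)
  have D: "distr M borel (X i) = D" if "i \<in> {1..n}" for i
  proof (rule cdf_unique)
    show "real_distribution (distr M borel (X i))" using meas[OF that] by (rule real_distribution_distr)
    show "cdf (distr M borel (X i)) = cdf D" using cdf[OF that] cdf[of 1] nk by (simp add: D_def)
  qed (rule D.real_distribution_axioms)
  have cdf_D: "cdf D = pareto_cdf \<alpha> \<delta>" using cdf[of 1] nk by (simp add: D_def)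
  have atomless: "measure D {t} = 0" for t
    using isCont_pareto_cdf[OF \<alpha>\<delta>] unfolding D.isCont_cdf[symmetric] cdf_D by simp
  have upper: "measure D {t<..} = (\<delta> / max \<delta> t) powr \<alpha>" for t
  proof -
    have "measure D {t<..} = 1 - cdf D t"
      unfolding cdf_def by (subst D.prob_compl[symmetric]) (auto intro!: arg_cong[where f = "measure D"])
    then show ?thesis by (simp add: cdf_D pareto_cdf_eq[OF \<alpha>\<delta>])
  qed
  \<comment> \<open>Below \<delta> the upper tail is constantly one and the scaling identity can
    fail, so \<open>tail\<close> is claimed only almost everywhere.\<close>
  have gt_\<delta>: "AE t in D. \<delta> < t"
  proof -
    have "measure D {\<delta><..} = 1" using upper[of \<delta>] \<alpha>\<delta> by simp
    then show ?thesis using D.prob_eq_1[of "{\<delta><..}"] by simp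
  qed
  have tail: "AE t in D. t \<le> exp y * t \<and> measure D {exp y * t<..} = exp (- \<alpha> * y) * measure D {t<..}"
    using gt_\<delta>
  proof eventually_elim
    case (elim t)
    have "1 \<le> exp y" using y by simp
    then have le: "t \<le> exp y * t" using mult_right_mono[of 1 "exp y" t] elim \<alpha>\<delta> by simp
    have "(\<delta> / (exp y * t)) powr \<alpha> = (exp (- y) * (\<delta> / t)) powr \<alpha>" by (simp add: exp_minus field_simps)
    also have "\<dots> = exp (- y) powr \<alpha> * (\<delta> / t) powr \<alpha>" using elim \<alpha>\<delta> by (intro powr_mult)
    also have "exp (- y) powr \<alpha> = exp (- \<alpha> * y)" by (simp add: powr_def)
    finally show ?case using le elim by (simp add: upper max_def)
  qed
  let ?P = "PiM {1..n} (\<lambda>_. D)"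
  have emb: "(\<lambda>\<omega>. \<lambda>i\<in>{1..n}. X i \<omega>) \<in> measurable M (PiM {1..n} (\<lambda>_. borel))"
    using meas by (intro measurable_restrict) auto
  have P_eq: "distr M (PiM {1..n} (\<lambda>_. borel)) (\<lambda>\<omega>. \<lambda>i\<in>{1..n}. X i \<omega>) = ?P"
  proof -
    have "distr M (PiM {1..n} (\<lambda>_. borel)) (\<lambda>\<omega>. \<lambda>i\<in>{1..n}. X i \<omega>) = PiM {1..n} (\<lambda>i. distr M borel (X i))"
      using nk indep meas by (subst indep_vars_iff_distr_eq_PiM'[symmetric]) (auto simp: n_def)
    also have "\<dots> = ?P" using D by (intro PiM_cong) auto
    finally show ?thesis .
  qed
  have X_gt: "AE \<omega> in M. \<forall>i\<in>{1..n}. \<delta> < X i \<omega>"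
  proof (intro AE_finite_allI)
    fix i assume i: "i \<in> {1..n}"
    have "AE t in distr M borel (X i). \<delta> < t" unfolding D[OF i] by (rule gt_\<delta>)
    then show "AE \<omega> in M. \<delta> < X i \<omega>" using meas[OF i] by (simp add: AE_distr_iff)
  qed simp
  have [measurable]: "(\<lambda>x. x j) \<in> borel_measurable (PiM {1..n} (\<lambda>_. borel :: real measure))" if "j \<in> {1..n}" for j
    using that by (intro measurable_component_singleton)
  have [measurable]: "(\<lambda>x. order_stat k n x) \<in> borel_measurable (PiM {1..n} (\<lambda>_. borel))"
      "(\<lambda>x. order_stat (k * s) n x) \<in> borel_measurable (PiM {1..n} (\<lambda>_. borel))"
    using nk by (auto intro!: borel_measurable_order_stat)
  \<comment> \<open>Off a null set both order statistics are positive, so \<open>ln\<close> and the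
    quotient can be undone.\<close>
  have "prob {\<omega> \<in> space M. log_ratio k s (\<lambda>i. X i \<omega>) \<le> y} =
    prob {\<omega> \<in> space M. order_stat (k * s) n (\<lambda>i. X i \<omega>) \<le> exp y * order_stat k n (\<lambda>i. X i \<omega>)}"
  proof (rule finite_measure_eq_AE)
    show "AE \<omega> in M. \<omega> \<in> {\<omega> \<in> space M. log_ratio k s (\<lambda>i. X i \<omega>) \<le> y} \<longleftrightarrow>
       \<omega> \<in> {\<omega> \<in> space M. order_stat (k * s) n (\<lambda>i. X i \<omega>) \<le> exp y * order_stat k n (\<lambda>i. X i \<omega>)}"
      using X_gt
    proof eventually_elim
      case (elim \<omega>)
      let ?x = "\<lambda>i. X i \<omega>"
      have pos: "order_stat i n ?x > 0" if "1 \<le> i" "i \<le> n" for i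
        using order_stat_mem[OF that, of ?x] elim \<alpha>\<delta> by force
      then have "order_stat (k * s) n ?x > 0" "order_stat k n ?x > 0" using nk by auto
      then show ?case
        using ln_le_cancel_iff[of "order_stat (k * s) n ?x / order_stat k n ?x" "exp y"]
        unfolding log_ratio_def n_eq by (simp add: pos_divide_le_eq)
    qed
  qed (unfold log_ratio_def n_eq, measurable)
  also have "\<dots> = measure ?P {x \<in> space ?P. order_stat (k * s) n x \<le> exp y * order_stat k n x}"
  proof -
    let ?B = "PiM {1..n} (\<lambda>_. borel :: real measure)" and ?Y = "\<lambda>\<omega>. \<lambda>i\<in>{1..n}. X i \<omega>"
    let ?E = "{x \<in> space ?B. order_stat (k * s) n x \<le> exp y * order_stat k n x}"
    have "?E \<in> sets ?B" by measurable
    then have "measure (distr M ?B ?Y) ?E = prob (?Y -` ?E \<inter> space M)"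
      by (rule measure_distr[OF emb])
    also have "?Y -` ?E \<inter> space M =
        {\<omega> \<in> space M. order_stat (k * s) n (\<lambda>i. X i \<omega>) \<le> exp y * order_stat k n (\<lambda>i. X i \<omega>)}"
      using measurable_space[OF emb] unfolding vimage_def Int_def mem_Collect_eq order_stat_restrict by blast
    finally show ?thesis unfolding P_eq[symmetric] space_distr by (rule sym)
  qed
  also have "\<dots> = measure (binomial_pmf (k * s - 1) (exp (- \<alpha> * y))) {..k - 1}"
    using D.prob_order_stat_le[OF atomless _ _ _ tail nk(1-4)] y \<alpha>\<delta> by (simp add: nk(5,6))
  finally show "prob {\<omega> \<in> space M. log_ratio k s (\<lambda>i. X i \<omega>) \<le> y} =
      measure (binomial_pmf (k * s - 1) (exp (- \<alpha> * y))) {..k - 1}" .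
qed

text \<open>Every sample size has its own probability space, since only the law at each
  \<open>k\<close> enters the limit. The assumptions start at \<open>k = 1\<close>.\<close>

theorem mainTheorem7:
  fixes M :: "nat \<Rightarrow> 'a measure"
    and X :: "nat \<Rightarrow> nat \<Rightarrow> 'a \<Rightarrow> real"
    and \<alpha> \<delta> \<alpha>\<^sub>0 :: real
    and s :: nat
  assumes "\<alpha> > 0" and "\<delta> > 0" and "s \<ge> 2" and "0 < \<alpha>\<^sub>0" and "\<alpha>\<^sub>0 < 1"
    and "\<And>k. k \<ge> 1 \<Longrightarrow> prob_space (M k)"
    and "\<And>k. k \<ge> 1 \<Longrightarrow> prob_space.indep_vars (M k) (\<lambda>_. borel) (X k) {1..k * (s + 1) - 1}"
    and "\<And>k i. k \<ge> 1 \<Longrightarrow> i \<in> {1..k * (s + 1) - 1} \<Longrightarrow> pareto_rv (M k) (X k i) \<alpha> \<delta>"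
  shows "(\<lambda>k. measure (M k) {\<omega> \<in> space (M k).
            \<alpha> \<in> {ln (real s) / log_ratio k s (\<lambda>i. X k i \<omega>) - ci_halfwidth \<alpha>\<^sub>0 k s (\<lambda>i. X k i \<omega>) ..
                 ln (real s) / log_ratio k s (\<lambda>i. X k i \<omega>) + ci_halfwidth \<alpha>\<^sub>0 k s (\<lambda>i. X k i \<omega>)}})
         \<longlonglongrightarrow> 1 - \<alpha>\<^sub>0"
proof -
  interpret N: real_distribution std_normal_distribution by (rule real_dist_normal_dist)
  define z where "z = quantile std_normal_distribution (1 - \<alpha>\<^sub>0 / 2)"
  define L where "L k \<omega> = log_ratio k s (\<lambda>i. X k i \<omega>)" for k \<omega>
  define \<sigma> where "\<sigma> k = ratio_scale k s" for k
  \<comment> \<open>A pivot: by \<open>prob_L\<close> and positivity of \<open>L\<close>, the law of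
    \<open>\<alpha> * L k \<omega>\<close> involves neither \<alpha> nor \<delta>.\<close>
  define T where "T k \<omega> = (\<alpha> * L k \<omega> - ln (real s)) / \<sigma> k" for k \<omega>
  have meas_L: "L k \<in> borel_measurable (M k)"
    and prob_L: "\<And>y. y \<ge> 0 \<Longrightarrow> measure (M k) {\<omega> \<in> space (M k). L k \<omega> \<le> y} =
      measure (binomial_pmf (k * s - 1) (exp (- \<alpha> * y))) {..k - 1}" if "k \<ge> 1" for k
    using prob_space.prob_log_ratio_le[OF assms(6)[OF that] assms(1,2) that _ _ assms(7)[OF that] assms(8)[OF that]]
      assms(3) unfolding L_def[abs_def] by auto
  have \<sigma>_pos: "\<sigma> k > 0" if "k \<ge> 1" for k
    unfolding \<sigma>_def using that assms(3) by (rule ratio_scale_pos)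
  have meas_T: "T k \<in> borel_measurable (M k)" if "k \<ge> 1" for k
    using meas_L[OF that] unfolding T_def[abs_def] by measurable
  have L_pos: "AE \<omega> in M k. L k \<omega> > 0" if k: "k \<ge> 1" for k
  proof -
    interpret prob_space "M k" by (rule assms(6)[OF k])
    \<comment> \<open>At \<open>y = 0\<close> the success probability is 1, so the binomial variable
      equals \<open>k * s - 1\<close>, which exceeds \<open>k - 1\<close> because
      \<open>s \<ge> 2\<close>.\<close>
    have "k * 2 \<le> k * s" using assms(3) by simp
    then have "k - 1 < k * s - 1" using k by linarith
    then have "prob {\<omega> \<in> space (M k). L k \<omega> \<le> 0} = 0"
      using prob_L[OF k, of 0] by (simp add: measure_pmf_zero_iff)
    then have "AE \<omega> in M k. \<not> L k \<omega> \<le> 0"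
      using meas_L[OF k] by (subst (asm) prob_eq_0) (auto elim!: AE_mp)
    then show ?thesis by (simp add: not_le)
  qed
  \<comment> \<open>The shift to \<open>Suc k\<close> skips the unconstrained \<open>M 0\<close>, so
    that every member of the sequence is a probability law.\<close>
  have weak: "weak_conv_m (\<lambda>k. distr (M (Suc k)) borel (T (Suc k))) std_normal_distribution"
    unfolding weak_conv_m_def weak_conv_def
  proof (intro allI impI)
    fix u :: real
    \<comment> \<open>\<open>prob_L\<close> holds only for nonnegative arguments; for negative
      \<open>u\<close> this is secured by \<open>\<sigma> k\<close> tending to 0 while
      \<open>ln s > 0\<close>.\<close>
    have "(\<lambda>k. ln (real s) + u * \<sigma> k) \<longlonglongrightarrow> ln (real s) + u * 0"
      unfolding \<sigma>_def by (intro tendsto_intros ratio_scale_limit assms(3))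
    then have "eventually (\<lambda>k. 0 < ln (real s) + u * \<sigma> k) sequentially"
      by (rule order_tendstoD) (use assms(3) in simp)
    then have "eventually (\<lambda>k. measure (binomial_pmf (k * s - 1) (exp (- (ln (real s) + u * ratio_scale k s)))) {..k - 1}
       = cdf (distr (M k) borel (T k)) u) sequentially"
      using eventually_ge_at_top[of 1]
    proof eventually_elim
      case (elim k)
      have "cdf (distr (M k) borel (T k)) u = measure (M k) {\<omega> \<in> space (M k). L k \<omega> \<le> (ln (real s) + u * \<sigma> k) / \<alpha>}"
        unfolding cdf_def using meas_T[OF elim(2)] \<sigma>_pos[OF elim(2)] assms(1)
        by (subst measure_distr) (auto intro!: arg_cong[where f = "measure (M k)"] simp: T_def field_simps)
      also have "\<dots> = measure (binomial_pmf (k * s - 1) (exp (- (ln (real s) + u * ratio_scale k s)))) {..k - 1}"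
        using elim assms(1) by (subst prob_L) (auto simp: \<sigma>_def)
      finally show ?case ..
    qed
    then have "(\<lambda>k. cdf (distr (M k) borel (T k)) u) \<longlonglongrightarrow> cdf std_normal_distribution u"
      by (rule Lim_transform_eventually[OF binomial_tail_limit[OF assms(3)]])
    then show "(\<lambda>k. cdf (distr (M (Suc k)) borel (T (Suc k))) u) \<longlonglongrightarrow> cdf std_normal_distribution u"
      by (rule LIMSEQ_Suc)
  qed
  have "(\<lambda>k. measure (distr (M (Suc k)) borel (T (Suc k))) {- z..z}) \<longlonglongrightarrow> measure std_normal_distribution {- z..z}"
  proof (rule weak_conv_imp_continuity_set_conv[OF _ _ weak])
    show "real_distribution (distr (M (Suc k)) borel (T (Suc k)))" for k
      using assms(6) meas_T by (intro prob_space.real_distribution_distr) auto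
    have "frontier {- z..z} \<subseteq> {- z} \<union> {z}" by (auto simp: frontier_def)
    then have "emeasure std_normal_distribution (frontier {- z..z}) \<le> emeasure std_normal_distribution ({- z} \<union> {z})"
      by (intro emeasure_mono) auto
    also have "\<dots> \<le> 0"
      by (intro order_trans[OF emeasure_subadditive]) (auto simp: N.emeasure_eq_measure std_normal_atomless)
    finally show "emeasure std_normal_distribution (frontier {- z..z}) = 0" by simp
  qed (auto intro: real_dist_normal_dist)
  then have "(\<lambda>k. measure (distr (M k) borel (T k)) {- z..z}) \<longlonglongrightarrow> measure std_normal_distribution {- z..z}"
    by (rule LIMSEQ_imp_Suc)
  then have lim: "(\<lambda>k. measure (distr (M k) borel (T k)) {- z..z}) \<longlonglongrightarrow> 1 - \<alpha>\<^sub>0"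
    unfolding z_def prob_std_normal_symmetric_interval[OF assms(4,5)] .
  show ?thesis
  proof (rule Lim_transform_eventually[OF lim eventually_mono[OF eventually_ge_at_top[of 1]]])
    fix k :: nat assume k: "1 \<le> k"
    interpret prob_space "M k" by (rule assms(6)[OF k])
    note [measurable] = meas_L[OF k] meas_T[OF k]
    have "measure (distr (M k) borel (T k)) {- z..z} = prob {\<omega> \<in> space (M k). T k \<omega> \<in> {- z..z}}"
      by (subst measure_distr) (auto intro!: arg_cong[where f = prob])
    also have "\<dots> = prob {\<omega> \<in> space (M k). \<alpha> \<in> {ln (real s) / L k \<omega> - z / L k \<omega> * \<sigma> k .. ln (real s) / L k \<omega> + z / L k \<omega> * \<sigma> k}}"
    proof (rule finite_measure_eq_AE)
      show "AE \<omega> in M k. \<omega> \<in> {\<omega> \<in> space (M k). T k \<omega> \<in> {- z..z}} \<longleftrightarrow>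
        \<omega> \<in> {\<omega> \<in> space (M k). \<alpha> \<in> {ln (real s) / L k \<omega> - z / L k \<omega> * \<sigma> k .. ln (real s) / L k \<omega> + z / L k \<omega> * \<sigma> k}}"
        using L_pos[OF k]
      proof eventually_elim
        case (elim \<omega>)
        have "T k \<omega> \<in> {- z..z} \<longleftrightarrow> ln (real s) - z * \<sigma> k \<le> \<alpha> * L k \<omega> \<and> \<alpha> * L k \<omega> \<le> ln (real s) + z * \<sigma> k"
          using \<sigma>_pos[OF k] by (auto simp: T_def field_simps)
        also have "\<dots> \<longleftrightarrow> (ln (real s) - z * \<sigma> k) / L k \<omega> \<le> \<alpha> \<and> \<alpha> \<le> (ln (real s) + z * \<sigma> k) / L k \<omega>"
          using elim by (simp add: pos_divide_le_eq pos_le_divide_eq)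
        finally show ?case by (simp add: add_divide_distrib diff_divide_distrib)
      qed
    qed (unfold atLeastAtMost_iff, measurable)
    finally show "measure (distr (M k) borel (T k)) {- z..z} = measure (M k) {\<omega> \<in> space (M k).
            \<alpha> \<in> {ln (real s) / log_ratio k s (\<lambda>i. X k i \<omega>) - ci_halfwidth \<alpha>\<^sub>0 k s (\<lambda>i. X k i \<omega>) ..
                 ln (real s) / log_ratio k s (\<lambda>i. X k i \<omega>) + ci_halfwidth \<alpha>\<^sub>0 k s (\<lambda>i. X k i \<omega>)}}"
      unfolding ci_halfwidth_def L_def z_def \<sigma>_def ratio_scale_def .
  qed
qed

end
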